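(* Let $\lambda$ be a regular cardinal with $\aleph_1<\lambda<2^{\aleph_0}$, let $\kappa<2^{\aleph_0}$, and let $d_i$ ($i<\kappa$) be metrics on $\lambda$. Then there is an ultrametric $d$ on $\lambda$ such that for no $i<\kappa$ and no $K\ge1$ is there an injection $f:\lambda\to\lambda$ with $d(x,y)/K\le d_i(f(x),f(y))\le K d(x,y)$ for all $x,y<\lambda$. In particular, there is no single metric space of cardinality $\lambda$ into which every ultrametric space of cardinality $\lambda$ is bi-Lipschitz embedded (and hence none into which every such space is almost isometrically embedded).
   Context: An ultrametric is a metric $d$ satisfying $d(x,z)\le\max\{d(x,y),d(y,z)\}$. A bi-Lipschitz embedding is an injection $f$ with $d(x,y)/K\le d'(f(x),f(y))\le Kd(x,y)$ for some constant $K\ge1$. $X$ is almost isometrically embedded in $Y$ if for every $\lambda>1$ there is an injection $f:X\to Y$ with $d(f(a),f(b))<\lambda d(a,b)$ and $d(a,b)<\lambda d(f(a),f(b))$ for distinct $a,b$. *)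

theory Defs
  imports Main "HOL.Real"
begin

definition metric_on :: "'a set \<Rightarrow> ('a \<Rightarrow> 'a \<Rightarrow> real) \<Rightarrow> bool" where
  "metric_on L d \<longleftrightarrow>
     (\<forall>x\<in>L. \<forall>y\<in>L. 0 \<le> d x y \<and> (d x y = 0 \<longleftrightarrow> x = y) \<and> d x y = d y x) \<and>
     (\<forall>x\<in>L. \<forall>y\<in>L. \<forall>z\<in>L. d x z \<le> d x y + d y z)"

definition ultrametric_on :: "'a set \<Rightarrow> ('a \<Rightarrow> 'a \<Rightarrow> real) \<Rightarrow> bool" where
  "ultrametric_on L d \<longleftrightarrow> metric_on L d \<and>
     (\<forall>x\<in>L. \<forall>y\<in>L. \<forall>z\<in>L. d x z \<le> max (d x y) (d y z))"

definition bilip_embeds ::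
  "'a set \<Rightarrow> ('a \<Rightarrow> 'a \<Rightarrow> real) \<Rightarrow> 'b set \<Rightarrow> ('b \<Rightarrow> 'b \<Rightarrow> real) \<Rightarrow> bool" where
  "bilip_embeds L d M e \<longleftrightarrow>
     (\<exists>K::real. K \<ge> 1 \<and> (\<exists>f. inj_on f L \<and> f ` L \<subseteq> M \<and>
        (\<forall>x\<in>L. \<forall>y\<in>L. d x y / K \<le> e (f x) (f y) \<and> e (f x) (f y) \<le> K * d x y)))"

definition almost_isom_embeds ::
  "'a set \<Rightarrow> ('a \<Rightarrow> 'a \<Rightarrow> real) \<Rightarrow> 'b set \<Rightarrow> ('b \<Rightarrow> 'b \<Rightarrow> real) \<Rightarrow> bool" where
  "almost_isom_embeds L d M e \<longleftrightarrow>
     (\<forall>l::real. l > 1 \<longrightarrow> (\<exists>f. inj_on f L \<and> f ` L \<subseteq> M \<and>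
        (\<forall>a\<in>L. \<forall>b\<in>L. a \<noteq> b \<longrightarrow> e (f a) (f b) < l * d a b \<and> d a b < l * e (f a) (f b))))"

end

theory Submission
  imports Defs Complex_Main
begin

text \<open>
  By club guessing there are \<open>\<lambda>\<close> many increasing \<open>\<omega>\<close>-sequences in \<open>\<lambda>\<close> such that every club contains
  the range of one of them. Identify \<open>\<lambda>\<close> with the tree consisting of these sequences and of all finite
  sequences, and for \<open>t \<in> (0,1)\<close> let \<open>d\<^sub>t\<close> be the ultrametric \<open>t\<^sup>n\<close>, with \<open>n\<close> the first place of
  difference. If \<open>f\<close> is a bi-Lipschitz embedding of \<open>d\<^sub>t\<close> into a metric \<open>e\<close> on \<open>\<lambda>\<close>, take a guessing
  sequence \<open>a\<close> consisting of ordinals closed under \<open>f\<close>, the coding of the tree, and approximation of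
  points by the range of \<open>f\<close>. Then the \<open>e\<close>-distance of \<open>y = f a\<close> from the initial segment \<open>a n\<close> is
  \<open>t\<^sup>n\<close> up to a constant factor, so \<open>e\<close>, \<open>y\<close> and \<open>a\<close> determine \<open>t\<close>. Fewer than \<open>2\<^sup>\<aleph>\<^sup>0\<close> values of \<open>t\<close>
  arise in this way; any other \<open>t\<close> works.
\<close>

unbundle cardinal_syntax

section \<open>Order and cardinal arithmetic of a regular cardinal above \<aleph>_1\<close>

locale regular_cardinal =
  fixes r :: "'a rel"
  assumes Card_order: "Card_order r"
    and regular: "regularCard r"
    and aleph1_less: "cardSuc natLeq <o r"
begin

abbreviation L :: "'a set" where "L \<equiv> Field r"

abbreviation le :: "'a \<Rightarrow> 'a \<Rightarrow> bool" (infix "\<preceq>" 50) where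
  "x \<preceq> y \<equiv> (x, y) \<in> r"

abbreviation lt :: "'a \<Rightarrow> 'a \<Rightarrow> bool" (infix "\<prec>" 50) where
  "x \<prec> y \<equiv> x \<noteq> y \<and> (x, y) \<in> r"

abbreviation small :: "'b set \<Rightarrow> bool" where
  "small A \<equiv> |A| <o r"

lemma Well_order: "Well_order r"
  using Card_order by (simp add: card_order_on_def)

lemma wo: "wo_rel r"
  using Well_order by (simp add: wo_rel_def)

lemma le_trans: "x \<preceq> y \<Longrightarrow> y \<preceq> z \<Longrightarrow> x \<preceq> z"
  using wo_rel.TRANS[OF wo] by (meson transD)

lemma le_antisym: "x \<preceq> y \<Longrightarrow> y \<preceq> x \<Longrightarrow> x = y"
  using wo_rel.ANTISYM[OF wo] by (meson antisymD)

lemma le_refl: "x \<in> L \<Longrightarrow> x \<preceq> x"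
  using wo_rel.REFL[OF wo] by (meson refl_onD)

lemma le_lt_trans: "x \<preceq> y \<Longrightarrow> y \<prec> z \<Longrightarrow> x \<prec> z"
  by (metis le_antisym le_trans)

lemma lt_le_trans: "x \<prec> y \<Longrightarrow> y \<preceq> z \<Longrightarrow> x \<prec> z"
  by (metis le_antisym le_trans)

lemma not_lt: "x \<in> L \<Longrightarrow> y \<in> L \<Longrightarrow> \<not> x \<prec> y \<longleftrightarrow> y \<preceq> x"
  using wo_rel.TOTALS[OF wo] le_antisym le_refl by metis

lemma ex_least:
  assumes "S \<subseteq> L" "S \<noteq> {}"
  obtains m where "m \<in> S" "\<And>x. x \<in> S \<Longrightarrow> m \<preceq> x"
  using wo_rel.minim_in[OF wo assms] wo_rel.minim_least[OF wo assms(1)] by blast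

lemma natLeq_less: "natLeq <o r"
  using aleph1_less cardSuc_greater[OF natLeq_Card_order] ordLess_transitive by blast

lemma infinite_L: "infinite L"
proof
  assume "finite L"
  then have "|L| <o natLeq" using finite_iff_ordLess_natLeq by blast
  then have "r <o natLeq"
    using card_of_Field_ordIso[OF Card_order] ordIso_symmetric ordIso_ordLess_trans by blast
  then show False using natLeq_less ordLess_transitive ordLess_irreflexive by blast
qed

lemma Cinfinite: "Cinfinite r"
  using infinite_L Card_order by (simp add: cinfinite_def)

lemma small_nat: "small (UNIV :: nat set)"
  using card_of_nat natLeq_less ordIso_ordLess_trans by blast

lemma small_image: "small A \<Longrightarrow> small (f ` A)"
  using card_of_image ordLeq_ordLess_trans by blast

lemma small_subset: "small B \<Longrightarrow> A \<subseteq> B \<Longrightarrow> small A"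
  using card_of_mono1 ordLeq_ordLess_trans by blast

lemma small_UN: "small I \<Longrightarrow> (\<And>i. i \<in> I \<Longrightarrow> small (A i)) \<Longrightarrow> small (\<Union>i\<in>I. A i)"
  using card_of_UNION_ordLess_infinite_Field_regularCard[OF regular Cinfinite] by blast

lemma small_Un: "small A \<Longrightarrow> small B \<Longrightarrow> small (A \<union> B)"
  using card_of_Un_ordLess_infinite_Field[OF infinite_L Card_order] by blast

lemma small_finite: "finite A \<Longrightarrow> small A"
  using finite_iff_ordLess_natLeq natLeq_less ordLess_transitive by blast

text \<open>Induction on the length handles lists of a fixed length; the union over all lengths
  stays small because \<open>r\<close> is regular and uncountable.\<close>

lemma small_lists:
  assumes "small A"
  shows "small (lists A)"
proof -
  have len: "small {l \<in> lists A. length l = n}" for n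
  proof (induction n)
    case 0
    show ?case by (rule small_finite) (simp add: finite_subset[of _ "{[]}"] subset_iff)
  next
    case (Suc n)
    have "{l \<in> lists A. length l = Suc n} \<subseteq> (\<Union>a\<in>A. Cons a ` {l \<in> lists A. length l = n})"
      by (auto simp: length_Suc_conv image_iff lists_eq_set)
    then show ?case
      by (rule small_subset[rotated]) (intro small_UN small_image assms Suc)
  qed
  have "lists A \<subseteq> (\<Union>n. {l \<in> lists A. length l = n})" by auto
  then show ?thesis
    by (rule small_subset[rotated]) (intro small_UN small_nat len)
qed

lemma ex_gt: "x \<in> L \<Longrightarrow> \<exists>y\<in>L. x \<prec> y"
  using infinite_Card_order_limit[OF Card_order infinite_L] by blast

lemma bounded:
  assumes "K \<subseteq> L" "small K"
  shows "\<exists>u\<in>L. \<forall>k\<in>K. k \<prec> u"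
proof -
  have "\<not> cofinal K r"
    using assms regular not_ordLess_ordIso unfolding regularCard_def by blast
  then obtain a where a: "a \<in> L" "\<forall>b\<in>K. \<not> a \<prec> b"
    unfolding cofinal_def by blast
  \<comment> \<open>Failure of cofinality makes \<open>a\<close> only a weak bound for
    \<open>K\<close>; one step beyond it gives a strict bound.\<close>
  obtain u where "u \<in> L" "a \<prec> u" using ex_gt[OF a(1)] by blast
  then show ?thesis using a assms(1) not_lt le_lt_trans by (metis subsetD)
qed

lemma small_below: "x \<in> L \<Longrightarrow> small {y. y \<preceq> x}"
proof -
  assume x: "x \<in> L"
  obtain u where u: "u \<in> L" "x \<prec> u" using ex_gt[OF x] by blast
  have "{y. y \<preceq> x} \<subseteq> underS r u"
    using le_lt_trans[OF _ u(2)] by (auto simp: underS_def)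
  then show ?thesis
    using card_of_underS[OF Card_order u(1)] small_subset by blast
qed

text \<open>Uncountable cofinality bounds the range of \<open>s\<close>, and the least bound is
  strict because \<open>s\<close> increases strictly.\<close>

lemma sup_of_sequence:
  assumes "\<And>n. s n \<in> L" "\<And>n. s n \<prec> s (Suc n)"
  obtains \<delta> where "\<delta> \<in> L" "\<And>n. s n \<prec> \<delta>" "\<And>\<beta>. \<beta> \<prec> \<delta> \<Longrightarrow> \<exists>n. \<beta> \<prec> s n"
proof -
  let ?U = "{u \<in> L. \<forall>n. s n \<preceq> u}"
  have "\<exists>u\<in>L. \<forall>k\<in>range s. k \<prec> u"
    using assms(1) small_image[OF small_nat] by (intro bounded) auto
  then have "?U \<noteq> {}" by auto
  then obtain \<delta> where d: "\<delta> \<in> ?U" "\<And>u. u \<in> ?U \<Longrightarrow> \<delta> \<preceq> u"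
    using ex_least[of ?U] by auto
  show thesis
  proof
    show "\<delta> \<in> L" using d by simp
    show "s n \<prec> \<delta>" for n
      using d(1) assms(2)[of n] lt_le_trans[of "s n" "s (Suc n)" \<delta>] by blast
    show "\<exists>n. \<beta> \<prec> s n" if b: "\<beta> \<prec> \<delta>" for \<beta>
    proof (rule ccontr)
      assume c: "\<nexists>n. \<beta> \<prec> s n"
      have "\<beta> \<in> L" using b by (auto simp: Field_def)
      then have "\<beta> \<in> ?U" using c assms(1) not_lt by blast
      then show False using d(2) b le_antisym by blast
    qed
  qed
qed

section \<open>Closed unbounded sets\<close>

text \<open>The closedness condition also puts the least element of \<^term>\<open>L\<close> into every club, so that
  every element of \<^term>\<open>L\<close> has a club element below it.\<close>

definition club :: "'a set \<Rightarrow> bool" where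
  "club E \<longleftrightarrow> E \<subseteq> L \<and> (\<forall>x\<in>L. \<exists>y\<in>E. x \<prec> y) \<and>
     (\<forall>s\<in>L. (\<forall>\<beta>. \<beta> \<prec> s \<longrightarrow> (\<exists>y\<in>E. \<beta> \<prec> y \<and> y \<preceq> s)) \<longrightarrow> s \<in> E)"

lemma club_closed:
  "club E \<Longrightarrow> s \<in> L \<Longrightarrow> (\<And>\<beta>. \<beta> \<prec> s \<Longrightarrow> \<exists>y\<in>E. \<beta> \<prec> y \<and> y \<preceq> s) \<Longrightarrow> s \<in> E"
  unfolding club_def by blast

lemma club_unbounded: "club E \<Longrightarrow> x \<in> L \<Longrightarrow> \<exists>y\<in>E. x \<prec> y"
  unfolding club_def by blast

text \<open>The supremum \<open>m\<close> of the members of \<open>E\<close> up to \<open>x\<close>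
  belongs to \<open>E\<close> by closedness.\<close>

lemma club_floor:
  assumes "club E" "x \<in> L"
  shows "\<exists>m\<in>E. m \<preceq> x \<and> (\<forall>y\<in>E. y \<preceq> x \<longrightarrow> y \<preceq> m)"
proof -
  let ?U = "{u \<in> L. \<forall>y\<in>E. y \<preceq> x \<longrightarrow> y \<preceq> u}"
  have x: "x \<in> ?U" using assms(2) by blast
  then obtain m where m: "m \<in> ?U" "\<And>u. u \<in> ?U \<Longrightarrow> m \<preceq> u"
    using ex_least[of ?U] by auto
  have EL: "E \<subseteq> L" using assms(1) by (simp add: club_def)
  have "m \<in> E"
  proof (rule club_closed[OF assms(1)])
    show "m \<in> L" using m by simp
    fix \<beta> assume b: "\<beta> \<prec> m"
    then have "\<beta> \<in> L" by (auto simp: Field_def)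
    moreover have "\<beta> \<notin> ?U" using b m(2) le_antisym by blast
    ultimately obtain y where "y \<in> E" "y \<preceq> x" "\<not> y \<preceq> \<beta>" by blast
    then show "\<exists>y\<in>E. \<beta> \<prec> y \<and> y \<preceq> m"
      using m(1) EL \<open>\<beta> \<in> L\<close> not_lt[of \<beta> y] by blast
  qed
  then show ?thesis using m x by blast
qed

definition floor_in :: "'a set \<Rightarrow> 'a \<Rightarrow> 'a" where
  "floor_in E x = (SOME m. m \<in> E \<and> m \<preceq> x \<and> (\<forall>y\<in>E. y \<preceq> x \<longrightarrow> y \<preceq> m))"

lemma floor_in:
  assumes "club E" "x \<in> L"
  shows floor_in_mem: "floor_in E x \<in> E" and floor_in_le: "floor_in E x \<preceq> x"
    and floor_in_greatest: "y \<in> E \<Longrightarrow> y \<preceq> x \<Longrightarrow> y \<preceq> floor_in E x"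
proof -
  have "\<exists>m. m \<in> E \<and> m \<preceq> x \<and> (\<forall>y\<in>E. y \<preceq> x \<longrightarrow> y \<preceq> m)"
    using club_floor[OF assms] by blast
  from someI_ex[OF this, folded floor_in_def]
  show "floor_in E x \<in> E" "floor_in E x \<preceq> x"
    "y \<in> E \<Longrightarrow> y \<preceq> x \<Longrightarrow> y \<preceq> floor_in E x" by blast+
qed

text \<open>For unboundedness, start at \<open>x\<close> and pass \<omega> times to a bound for the
  values of \<open>h\<close> on the initial segment reached so far; the supremum is closed under
  \<open>h\<close>.\<close>

lemma club_closure_points:
  assumes h: "\<And>x. x \<in> L \<Longrightarrow> h x \<in> L"
  shows "club {\<alpha> \<in> L. \<forall>\<beta>. \<beta> \<prec> \<alpha> \<longrightarrow> h \<beta> \<prec> \<alpha>}"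
  unfolding club_def
proof (intro conjI ballI impI)
  let ?E = "{\<alpha> \<in> L. \<forall>\<beta>. \<beta> \<prec> \<alpha> \<longrightarrow> h \<beta> \<prec> \<alpha>}"
  show "?E \<subseteq> L" by blast
  show "s \<in> ?E" if s: "s \<in> L" "\<forall>\<beta>. \<beta> \<prec> s \<longrightarrow> (\<exists>y\<in>?E. \<beta> \<prec> y \<and> y \<preceq> s)" for s
  proof -
    have "h \<beta> \<prec> s" if "\<beta> \<prec> s" for \<beta>
    proof -
      obtain y where "y \<in> ?E" "\<beta> \<prec> y" "y \<preceq> s" using s(2) \<open>\<beta> \<prec> s\<close> by blast
      then show ?thesis using lt_le_trans[of "h \<beta>" y s] by blast
    qed
    then show ?thesis using s(1) by blast
  qed
  fix x assume x: "x \<in> L"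
  have step: "\<exists>v. v \<in> L \<and> u \<prec> v \<and> (\<forall>\<beta>. \<beta> \<preceq> u \<longrightarrow> h \<beta> \<prec> v)" if u: "u \<in> L" for u
  proof -
    have "{y. y \<preceq> u} \<subseteq> L" by (auto simp: Field_def)
    then have "\<exists>v\<in>L. \<forall>k\<in>insert u (h ` {y. y \<preceq> u}). k \<prec> v"
      using u h small_Un[OF small_finite[of "{u}"] small_image[OF small_below[OF u], of h]]
      by (intro bounded) auto
    then show ?thesis by blast
  qed
  then obtain v where v: "\<And>u. u \<in> L \<Longrightarrow> v u \<in> L \<and> u \<prec> v u \<and> (\<forall>\<beta>. \<beta> \<preceq> u \<longrightarrow> h \<beta> \<prec> v u)"
    by metis
  define s where "s n = (v ^^ n) x" for n
  have sL: "s n \<in> L" for n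
    by (induction n) (use x v in \<open>auto simp: s_def\<close>)
  then have s: "s n \<prec> s (Suc n) \<and> (\<forall>\<beta>. \<beta> \<preceq> s n \<longrightarrow> h \<beta> \<prec> s (Suc n))" for n
    using v[of "s n"] by (auto simp: s_def)
  obtain \<delta> where d: "\<delta> \<in> L" "\<And>n. s n \<prec> \<delta>" "\<And>\<beta>. \<beta> \<prec> \<delta> \<Longrightarrow> \<exists>n. \<beta> \<prec> s n"
    using sup_of_sequence[of s, OF sL conjunct1[OF s]] by metis
  have "h \<beta> \<prec> \<delta>" if "\<beta> \<prec> \<delta>" for \<beta>
  proof -
    obtain n where "\<beta> \<prec> s n" using d(3)[OF \<open>\<beta> \<prec> \<delta>\<close>] by blast
    then have "h \<beta> \<prec> s (Suc n)" using s by blast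
    then show ?thesis using lt_le_trans conjunct2[OF d(2)] by blast
  qed
  then have "\<delta> \<in> ?E" using d(1) by blast
  moreover have "x \<prec> \<delta>" using d(2)[of 0] by (simp add: s_def)
  ultimately show "\<exists>y\<in>?E. x \<prec> y" by (rule bexI[rotated])
qed

text \<open>Let \<open>h x\<close> exceed, for every \<open>j\<close>, some member of
  \<open>E j\<close> above \<open>x\<close>. Closedness puts every closure point of \<open>h\<close>
  into each \<open>E j\<close>, so unboundedness follows from
  \<open>club_closure_points\<close>.\<close>

lemma club_Inter:
  assumes "small J" and E: "\<And>j. j \<in> J \<Longrightarrow> club (E j)"
  shows "club {x \<in> L. \<forall>j\<in>J. x \<in> E j}"
proof -
  let ?E = "{x \<in> L. \<forall>j\<in>J. x \<in> E j}"
  have "\<exists>nx. \<forall>j\<in>J. \<forall>x\<in>L. nx j x \<in> E j \<and> x \<prec> nx j x"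
  proof (intro exI ballI)
    fix j x assume "j \<in> J" "x \<in> L"
    then have "\<exists>y. y \<in> E j \<and> x \<prec> y" using E unfolding club_def by blast
    then show "(SOME y. y \<in> E j \<and> x \<prec> y) \<in> E j \<and> x \<prec> (SOME y. y \<in> E j \<and> x \<prec> y)"
      by (rule someI_ex)
  qed
  then obtain nx where nx: "\<And>j x. j \<in> J \<Longrightarrow> x \<in> L \<Longrightarrow> nx j x \<in> E j \<and> x \<prec> nx j x"
    by blast
  have "\<exists>u\<in>L. \<forall>j\<in>J. nx j x \<prec> u" if "x \<in> L" for x
  proof -
    have "(\<lambda>j. nx j x) ` J \<subseteq> L" using nx[OF _ that] E unfolding club_def by blast
    from bounded[OF this small_image[OF assms(1)]] show ?thesis by blast
  qed
  then obtain h where h: "\<And>x. x \<in> L \<Longrightarrow> h x \<in> L \<and> (\<forall>j\<in>J. nx j x \<prec> h x)" by metis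
  define H where "H = {\<alpha> \<in> L. \<forall>\<beta>. \<beta> \<prec> \<alpha> \<longrightarrow> h \<beta> \<prec> \<alpha>}"
  have "\<alpha> \<in> ?E" if a: "\<alpha> \<in> L" "\<forall>\<beta>. \<beta> \<prec> \<alpha> \<longrightarrow> h \<beta> \<prec> \<alpha>" for \<alpha>
  proof -
    have "\<alpha> \<in> E j" if j: "j \<in> J" for j
    proof (rule club_closed[OF E[OF j] a(1)])
      fix \<beta> assume b: "\<beta> \<prec> \<alpha>"
      then have "\<beta> \<in> L" by (auto simp: Field_def)
      then show "\<exists>y\<in>E j. \<beta> \<prec> y \<and> y \<preceq> \<alpha>"
        using nx[OF j] h j a(2) b le_trans by meson
    qed
    then show ?thesis using a by blast
  qed
  then have sub: "H \<subseteq> ?E" by (auto simp only: H_def)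
  have H: "club H"
    unfolding H_def by (rule club_closure_points) (use h in blast)
  have unb: "\<exists>y\<in>?E. x \<prec> y" if "x \<in> L" for x
    using club_unbounded[OF H that] sub by blast
  have cl: "s \<in> ?E" if s: "s \<in> L" "\<forall>\<beta>. \<beta> \<prec> s \<longrightarrow> (\<exists>y\<in>?E. \<beta> \<prec> y \<and> y \<preceq> s)" for s
  proof -
    have "s \<in> E j" if j: "j \<in> J" for j
      by (rule club_closed[OF E[OF j] s(1)]) (use s(2) j in blast)
    then show ?thesis using s(1) by simp
  qed
  show ?thesis
    unfolding club_def using unb cl by (intro conjI ballI impI) simp_all
qed

end

section \<open>Club guessing\<close>

text \<open>Well-founded induction on \<open>p x\<close>: the next element \<open>m\<close> of
  \<open>W\<close> after \<open>x\<close> has a smaller value, so the part of \<open>W\<close> from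
  \<open>m\<close> on is finite, and hence so is the part from \<open>x\<close> on.\<close>

lemma finite_if_strictly_antitone:
  assumes w: "Well_order w" and W: "W \<subseteq> Field w" and R: "wf R"
    and dec: "\<And>x y. x \<in> W \<Longrightarrow> y \<in> W \<Longrightarrow> (x, y) \<in> w \<Longrightarrow> x \<noteq> y \<Longrightarrow> (p y, p x) \<in> R"
  shows "finite W"
proof -
  have wo: "wo_rel w" using w by (simp add: wo_rel_def)
  have least: "\<exists>m\<in>S. \<forall>x\<in>S. (m, x) \<in> w" if "S \<subseteq> W" "S \<noteq> {}" for S
    using that W wo_rel.minim_in[OF wo, of S] wo_rel.minim_least[OF wo, of S] by blast
  have fin: "finite {y \<in> W. (x, y) \<in> w}" if "x \<in> W" for x
    using that
  proof (induction "p x" arbitrary: x rule: wf_induct_rule[OF R])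
    case (1 x)
    let ?S = "{y \<in> W. (x, y) \<in> w \<and> y \<noteq> x}"
    have "finite ?S"
    proof (cases "?S = {}")
      case False
      then obtain m where m: "m \<in> ?S" "\<forall>y\<in>?S. (m, y) \<in> w" using least[of ?S] by blast
      then have "finite {y \<in> W. (m, y) \<in> w}" using 1 dec[of x m] by blast
      then show ?thesis by (rule rev_finite_subset) (use m in blast)
    next
      case True
      show ?thesis unfolding True by simp
    qed
    then have "finite (insert x ?S)" by simp
    then show ?case by (rule rev_finite_subset) blast
  qed
  show ?thesis
  proof (cases "W = {}")
    case False
    then obtain m where "m \<in> W" "\<forall>y\<in>W. (m, y) \<in> w" using least[of W] by blast
    then show ?thesis using fin[of m] by (simp add: Collect_conj_eq Int_absorb2 subset_iff)
  qed simp
qed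

context regular_cardinal
begin

text \<open>Shelah's club guessing. If no guessing sequence exists, then correcting \<open>c\<close> along a club \<open>E\<close>
  (by taking floors in \<open>E\<close>) never guesses some club \<open>\<Phi> E\<close>. Iterating this \<open>\<aleph>\<^sub>1\<close> times, at a limit point
  \<open>\<delta>\<close> of all the clubs the floor of each single \<open>c \<delta> n\<close> drops only finitely often, although one
  of these countably many floors drops at each of the \<open>\<aleph>\<^sub>1\<close> steps.\<close>

lemma club_guessing:
  "\<exists>b :: 'a \<Rightarrow> nat \<Rightarrow> 'a. \<forall>E. club E \<longrightarrow> (\<exists>\<delta>\<in>L. \<forall>n. b \<delta> n \<in> E \<and> b \<delta> n \<prec> b \<delta> (Suc n))"
proof (rule ccontr)
  assume neg: "\<not> ?thesis"
  define cofseq where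
    "cofseq \<delta> c \<longleftrightarrow> (\<forall>n::nat. c n \<prec> \<delta>) \<and> (\<forall>\<beta>. \<beta> \<prec> \<delta> \<longrightarrow> (\<exists>n. \<beta> \<preceq> c n))" for \<delta> c
  \<comment> \<open>Arbitrary where no cofinal sequence exists; only its value at the limit
    \<open>\<delta>\<close> constructed below is analysed.\<close>
  define c where "c \<delta> = (SOME s. cofseq \<delta> s)" for \<delta>
  define B where "B E \<delta> = range (\<lambda>n. floor_in E (c \<delta> n))" for E \<delta>
  \<comment> \<open>Choose an increasing sequence inside every \<open>B E \<delta>\<close> without a
    greatest element. By \<open>neg\<close> this choice misses some club \<open>E'\<close>, which
    therefore contains no such \<open>B E \<delta>\<close>.\<close>
  have "\<exists>E'. club E' \<and> (\<forall>\<delta>\<in>L. (\<forall>x\<in>B E \<delta>. \<exists>y\<in>B E \<delta>. x \<prec> y) \<longrightarrow> \<not> B E \<delta> \<subseteq> E')" for E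
  proof -
    define b where "b \<delta> = (SOME s. \<forall>n::nat. s n \<in> B E \<delta> \<and> s n \<prec> s (Suc n))" for \<delta>
    obtain E' where E': "club E'" "\<not> (\<exists>\<delta>\<in>L. \<forall>n. b \<delta> n \<in> E' \<and> b \<delta> n \<prec> b \<delta> (Suc n))"
      using neg by blast
    have "\<not> B E \<delta> \<subseteq> E'" if d: "\<delta> \<in> L" "\<forall>x\<in>B E \<delta>. \<exists>y\<in>B E \<delta>. x \<prec> y" for \<delta>
    proof
      assume sub: "B E \<delta> \<subseteq> E'"
      obtain g where g: "\<And>x. x \<in> B E \<delta> \<Longrightarrow> g x \<in> B E \<delta> \<and> x \<prec> g x" using d(2) by metis
      obtain x0 where x0: "x0 \<in> B E \<delta>" by (auto simp: B_def)
      have B: "(g ^^ n) x0 \<in> B E \<delta>" for n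
        by (induction n) (use x0 g in auto)
      then have "\<forall>n. (g ^^ n) x0 \<in> B E \<delta> \<and> (g ^^ n) x0 \<prec> (g ^^ Suc n) x0"
        using g by auto
      then have "\<exists>s. \<forall>n::nat. s n \<in> B E \<delta> \<and> s n \<prec> s (Suc n)"
        by (intro exI[of _ "\<lambda>n. (g ^^ n) x0"]) blast
      from someI_ex[OF this, folded b_def] show False using E'(2) sub d(1) by blast
    qed
    then show ?thesis using E'(1) by blast
  qed
  then obtain \<Phi> where \<Phi>: "\<And>E. club (\<Phi> E)"
    "\<And>E \<delta>. \<delta> \<in> L \<Longrightarrow> (\<forall>x\<in>B E \<delta>. \<exists>y\<in>B E \<delta>. x \<prec> y) \<Longrightarrow> \<not> B E \<delta> \<subseteq> \<Phi> E"
    by metis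
  let ?w = "cardSuc natLeq"
  have w: "Card_order ?w" "Well_order ?w" "wo_rel ?w"
    using cardSuc_Card_order[OF natLeq_Card_order] by (auto simp: card_order_on_def wo_rel_def)
  have wF: "|Field ?w| =o ?w" using card_of_Field_ordIso[OF w(1)] .
  then have smallw: "small (Field ?w)" using aleph1_less ordIso_ordLess_trans by blast
  \<comment> \<open>Recursion along \<omega>_1: stage \<open>\<xi>\<close> intersects the clubs
    \<open>\<Phi> (Es \<eta>)\<close> of all earlier stages, so the stages decrease.\<close>
  define Es where "Es = wfrec (?w - Id) (\<lambda>f \<xi>. {x \<in> L. \<forall>\<eta>\<in>underS ?w \<xi>. x \<in> \<Phi> (f \<eta>)})"
  have Es: "Es \<xi> = {x \<in> L. \<forall>\<eta>\<in>underS ?w \<xi>. x \<in> \<Phi> (Es \<eta>)}" for \<xi>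
    unfolding Es_def
    by (subst wfrec[OF wo_rel.WF[OF w(3)]]) (auto simp: cut_apply underS_def)
  have clubEs: "club (Es \<xi>)" for \<xi>
  proof -
    have "small (underS ?w \<xi>)"
      by (rule small_subset[OF smallw]) (auto simp: underS_def Field_def)
    then show ?thesis unfolding Es[of \<xi>] by (rule club_Inter) (rule \<Phi>(1))
  qed
  \<comment> \<open>Since \<omega>_1 is smaller than \<open>r\<close>, even the intersection of all
    stages is a club.\<close>
  define E where "E = {x \<in> L. \<forall>\<xi>\<in>Field ?w. x \<in> Es \<xi>}"
  have clubE: "club E" unfolding E_def by (rule club_Inter[OF smallw clubEs])
  then obtain nx where nx: "\<And>x. x \<in> L \<Longrightarrow> nx x \<in> E \<and> x \<prec> nx x"
    unfolding club_def by metis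
  obtain x0 where x0: "x0 \<in> L" using infinite_L by fastforce
  \<comment> \<open>The exponent is \<open>Suc n\<close> because \<open>x0\<close> itself need not
    lie in \<open>E\<close>.\<close>
  define s where "s n = (nx ^^ Suc n) x0" for n
  have EL: "E \<subseteq> L" by (auto simp: E_def)
  have sE: "s n \<in> E" for n
    by (induction n) (use x0 nx EL in \<open>auto simp: s_def\<close>)
  then have s: "s n \<prec> s (Suc n)" for n
    using nx[of "s n"] EL by (auto simp: s_def)
  obtain \<delta> where \<delta>: "\<delta> \<in> L" "\<And>n. s n \<prec> \<delta>" "\<And>\<beta>. \<beta> \<prec> \<delta> \<Longrightarrow> \<exists>n. \<beta> \<prec> s n"
    using sup_of_sequence[of s, OF subsetD[OF EL sE] s] by metis
  have "cofseq \<delta> s" unfolding cofseq_def using \<delta>(2,3) by blast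
  then have "cofseq \<delta> (c \<delta>)" unfolding c_def using someI[of "cofseq \<delta>" s] by simp
  then have c: "\<And>n. c \<delta> n \<prec> \<delta>" "\<And>\<beta>. \<beta> \<prec> \<delta> \<Longrightarrow> \<exists>n. \<beta> \<preceq> c \<delta> n"
    unfolding cofseq_def by blast+
  have cL: "c \<delta> n \<in> L" for n using c(1)[of n] by (auto simp: Field_def)
  \<comment> \<open>Each \<open>s k\<close> lies in \<open>Es \<xi>\<close>, so the floors of
    \<open>c \<delta>\<close> reach every \<open>s k\<close> while staying below
    \<open>\<delta>\<close>. Thus \<open>B (Es \<xi>) \<delta>\<close> has no greatest element and
    cannot lie inside \<open>\<Phi> (Es \<xi>)\<close>.\<close>
  have "\<exists>n. floor_in (Es \<xi>) (c \<delta> n) \<notin> \<Phi> (Es \<xi>)" if xi: "\<xi> \<in> Field ?w" for \<xi>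
  proof -
    have "\<exists>y\<in>B (Es \<xi>) \<delta>. x \<prec> y" if x: "x \<in> B (Es \<xi>) \<delta>" for x
    proof -
      obtain n where "x = floor_in (Es \<xi>) (c \<delta> n)" using x by (auto simp: B_def)
      then have "x \<prec> \<delta>"
        using le_lt_trans[OF floor_in_le[OF clubEs[of \<xi>] cL[of n]] c(1)] by simp
      then obtain k where k: "x \<prec> s k" using \<delta>(3) by blast
      obtain m where m: "s k \<preceq> c \<delta> m" using c(2) \<delta>(2) by blast
      have "s k \<in> Es \<xi>" using sE[of k] xi by (auto simp: E_def)
      then have "s k \<preceq> floor_in (Es \<xi>) (c \<delta> m)"
        using floor_in_greatest[OF clubEs cL _ m] by blast
      then show ?thesis using lt_le_trans[OF k] by (auto simp: B_def)
    qed
    then have "\<not> B (Es \<xi>) \<delta> \<subseteq> \<Phi> (Es \<xi>)" using \<Phi>(2)[OF \<delta>(1)] by blast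
    then show ?thesis by (auto simp: B_def)
  qed
  then obtain N where N: "\<And>\<xi>. \<xi> \<in> Field ?w \<Longrightarrow> floor_in (Es \<xi>) (c \<delta> (N \<xi>)) \<notin> \<Phi> (Es \<xi>)"
    by metis
  define W where "W n = {\<xi> \<in> Field ?w. N \<xi> = n}" for n
  \<comment> \<open>For fixed \<open>n\<close>, the later floor \<open>?p \<eta>\<close> lies in
    \<open>\<Phi> (Es \<xi>)\<close> and the earlier \<open>?p \<xi>\<close> does not, so the drop
    is strict.\<close>
  have "finite (W n)" for n
  proof (rule finite_if_strictly_antitone[OF w(2) _ wo_rel.WF[OF wo]])
    show "W n \<subseteq> Field ?w" by (auto simp: W_def)
    fix \<xi> \<eta> assume *: "\<xi> \<in> W n" "\<eta> \<in> W n" "(\<xi>, \<eta>) \<in> ?w" "\<xi> \<noteq> \<eta>"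
    let ?p = "\<lambda>\<xi>. floor_in (Es \<xi>) (c \<delta> n)"
    have "underS ?w \<xi> \<subseteq> underS ?w \<eta>"
      using *(3) wo_rel.TRANS[OF w(3)] wo_rel.ANTISYM[OF w(3)]
      unfolding underS_def by (auto dest: transD antisymD)
    then have "Es \<eta> \<subseteq> Es \<xi>" using Es[of \<xi>] Es[of \<eta>] by blast
    then have "?p \<eta> \<preceq> ?p \<xi>"
      using floor_in_greatest[OF clubEs cL _ floor_in_le[OF clubEs cL]]
        floor_in_mem[OF clubEs cL] by blast
    moreover have "?p \<eta> \<in> \<Phi> (Es \<xi>)"
      using floor_in_mem[OF clubEs cL, of \<eta> n] Es[of \<eta>] * by (auto simp: underS_def)
    moreover have "?p \<xi> \<notin> \<Phi> (Es \<xi>)" using N *(1) by (auto simp: W_def)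
    ultimately show "(?p \<eta>, ?p \<xi>) \<in> r - Id" by auto
  qed
  then have "|W n| \<le>o |UNIV :: nat set|" for n
    by (meson card_of_nat finite_iff_ordLess_natLeq ordIso_symmetric ordLess_imp_ordLeq
        ordLeq_ordIso_trans)
  then have "|\<Union>n. W n| \<le>o |UNIV :: nat set|"
    by (intro card_of_UNION_ordLeq_infinite ballI card_of_mono1) auto
  moreover have "(\<Union>n. W n) = Field ?w" by (auto simp: W_def)
  ultimately have "?w \<le>o natLeq"
    using wF card_of_nat by (metis ordIso_ordLeq_trans ordIso_symmetric ordLeq_ordIso_trans)
  then show False
    using cardSuc_greater[OF natLeq_Card_order] not_ordLess_ordLeq by blast
qed

end

section \<open>Tree ultrametrics and cardinality of products\<close>

text \<open>The tree metric with ratio \<open>t\<close>, pulled back along the labelling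
  \<open>\<phi>\<close>. The \<open>LEAST\<close> is meaningful only for points with different
  labels, which is why \<open>ultrametric_on_seq_dist\<close> takes \<open>\<phi>\<close>
  injective.\<close>

definition seq_dist :: "real \<Rightarrow> ('a \<Rightarrow> nat \<Rightarrow> 'c) \<Rightarrow> 'a \<Rightarrow> 'a \<Rightarrow> real" where
  "seq_dist t \<phi> x y = (if x = y then 0 else t ^ (LEAST n. \<phi> x n \<noteq> \<phi> y n))"

lemma seq_dist_ge:
  assumes "0 < t" "t < 1" "\<phi> x n \<noteq> \<phi> y n"
  shows "t ^ n \<le> seq_dist t \<phi> x y"
proof -
  have "(LEAST n. \<phi> x n \<noteq> \<phi> y n) \<le> n" using assms(3) by (rule Least_le)
  then have "t ^ n \<le> t ^ (LEAST n. \<phi> x n \<noteq> \<phi> y n)"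
    using assms(1,2) by (simp add: power_decreasing)
  then show ?thesis using assms(3) by (auto simp: seq_dist_def)
qed

lemma seq_dist_eq:
  assumes "\<phi> x n \<noteq> \<phi> y n" "\<And>k. k < n \<Longrightarrow> \<phi> x k = \<phi> y k"
  shows "seq_dist t \<phi> x y = t ^ n"
proof -
  have "(LEAST n. \<phi> x n \<noteq> \<phi> y n) = n"
    using assms by (intro Least_equality) (auto simp: not_less[symmetric])
  then show ?thesis using assms(1) by (auto simp: seq_dist_def)
qed

text \<open>Where \<open>x\<close> and \<open>z\<close> first differ, \<open>y\<close> must differ
  from one of them.\<close>

lemma ultrametric_on_seq_dist:
  assumes t: "0 < t" "t < 1" and inj: "inj_on \<phi> L"
  shows "ultrametric_on L (seq_dist t \<phi>)"
proof -
  have nonneg: "0 \<le> seq_dist t \<phi> x y" for x y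
    using t by (simp add: seq_dist_def)
  have ultra: "seq_dist t \<phi> x z \<le> max (seq_dist t \<phi> x y) (seq_dist t \<phi> y z)"
    if "x \<in> L" "z \<in> L" for x y z
  proof (cases "x = z")
    case True
    then show ?thesis using nonneg by (simp add: seq_dist_def le_max_iff_disj)
  next
    case False
    then have "\<exists>n. \<phi> x n \<noteq> \<phi> z n" using inj that by (metis ext inj_onD)
    then have n: "\<phi> x (LEAST n. \<phi> x n \<noteq> \<phi> z n) \<noteq> \<phi> z (LEAST n. \<phi> x n \<noteq> \<phi> z n)"
      by (rule LeastI_ex)
    define n where "n = (LEAST n. \<phi> x n \<noteq> \<phi> z n)"
    have "\<phi> x n \<noteq> \<phi> y n \<or> \<phi> y n \<noteq> \<phi> z n" using n n_def by metis
    then have "t ^ n \<le> seq_dist t \<phi> x y \<or> t ^ n \<le> seq_dist t \<phi> y z"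
      using seq_dist_ge[OF t] by metis
    then show ?thesis using False by (auto simp: seq_dist_def[of t \<phi> x z] n_def le_max_iff_disj)
  qed
  have tri: "seq_dist t \<phi> x z \<le> seq_dist t \<phi> x y + seq_dist t \<phi> y z" if "x \<in> L" "z \<in> L" for x y z
    using ultra[OF that, of y] nonneg[of x y] nonneg[of y z] by linarith
  have zero: "seq_dist t \<phi> x y = 0 \<longleftrightarrow> x = y" for x y
    using t by (simp add: seq_dist_def)
  have sym: "seq_dist t \<phi> x y = seq_dist t \<phi> y x" for x y
    by (simp add: seq_dist_def eq_commute)
  show ?thesis
    unfolding ultrametric_on_def metric_on_def
    by (intro conjI ballI nonneg zero sym tri ultra)
qed

text \<open>Otherwise the powers of \<open>t / s > 1\<close> would stay below \<open>C\<close>. The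
  exponents are positive to match \<open>rate\<close>.\<close>

lemma le_if_powers_le_const_mult:
  fixes t s C :: real
  assumes "0 < s" "\<And>n. t ^ Suc n \<le> C * s ^ Suc n"
  shows "t \<le> s"
proof (rule ccontr)
  assume "\<not> t \<le> s"
  then have gt: "1 < t / s" using assms(1) by simp
  then obtain n where n: "C < (t / s) ^ n" using real_arch_pow by blast
  also have "\<dots> \<le> (t / s) ^ Suc n" using gt by (intro power_increasing) auto
  also have "\<dots> \<le> C"
    using assms(2)[of n] assms(1) by (simp only: power_divide pos_divide_le_eq zero_less_power)
  finally show False by simp
qed

text \<open>The infinite set \<open>A <+> B\<close> is still smaller than \<open>C\<close> and
  absorbs the product. This counts triples of a metric, a point and a guessing sequence.\<close>

lemma card_of_Times_Times_ordLess:
  assumes "infinite C" "|A| <o |C|" "|B| <o |C|" "infinite B"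
  shows "|A \<times> B \<times> B| <o |C|"
proof -
  let ?S = "A <+> B"
  have S: "infinite ?S" using assms(4) by simp
  have "|A| \<le>o |?S|" "|B| \<le>o |?S|" by (simp_all add: card_of_Plus1 card_of_Plus2)
  moreover have "|?S| <o |C|" using card_of_Plus_ordLess_infinite assms(1-3) by blast
  ultimately have "|A \<times> B \<times> B| \<le>o |?S|"
    using S by (metis (no_types) Field_card_of card_of_Card_order card_of_Times_ordLeq_infinite_Field)
  then show ?thesis using \<open>|?S| <o |C|\<close> ordLeq_ordLess_trans by blast
qed

section \<open>Coding the tree by elements of the cardinal\<close>

context regular_cardinal
begin

text \<open>A finite list is bounded, so \<open>lists L\<close> is covered by \<open>r\<close> many
  small sets.\<close>

lemma card_of_lists_L: "|lists L| \<le>o r"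
proof -
  have "lists L \<subseteq> (\<Union>\<beta>\<in>L. lists {y. y \<preceq> \<beta>})"
  proof
    fix l assume "l \<in> lists L"
    then have "\<exists>u\<in>L. \<forall>k\<in>set l. k \<prec> u" by (intro bounded small_finite) auto
    then show "l \<in> (\<Union>\<beta>\<in>L. lists {y. y \<preceq> \<beta>})" by (auto simp: lists_eq_set)
  qed
  moreover have "|\<Union>\<beta>\<in>L. lists {y. y \<preceq> \<beta>}| \<le>o r"
    by (rule card_of_UNION_ordLeq_infinite_Field[OF infinite_L Card_order])
      (use card_of_Field_ordIso[OF Card_order] ordIso_imp_ordLeq ordLess_imp_ordLeq
        small_lists[OF small_below] in blast)+
  ultimately show ?thesis using card_of_mono1 ordLeq_transitive by blast
qed

text \<open>Padding with \<open>None\<close> gives finite and infinite sequences one type, and makes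
  a list differ from a proper extension first at the index equal to its length.\<close>

definition list_seq :: "'a list \<Rightarrow> nat \<Rightarrow> 'a option" where
  "list_seq l n = (if n < length l then Some (l ! n) else None)"

text \<open>There are at most \<open>r\<close> nodes, and the singleton lists already give
  \<open>|L|\<close> of them, so elements of \<open>L\<close> can name the nodes.\<close>

lemma ex_enumeration_of_sequences:
  fixes b :: "'a \<Rightarrow> nat \<Rightarrow> 'a"
  obtains \<phi> where "bij_betw \<phi> L (list_seq ` lists L \<union> (\<lambda>\<delta> n. Some (b \<delta> n)) ` L)"
proof -
  let ?P = "list_seq ` lists L \<union> (\<lambda>\<delta> n. Some (b \<delta> n)) ` L"
  have rL: "|L| =o r" using card_of_Field_ordIso[OF Card_order] .
  have "|list_seq ` lists L| \<le>o r" using card_of_image card_of_lists_L ordLeq_transitive by blast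
  moreover have "|(\<lambda>\<delta> n. Some (b \<delta> n)) ` L| \<le>o r"
    using card_of_image rL ordLeq_ordIso_trans by blast
  ultimately have "|?P| \<le>o r"
    using card_of_Un_ordLeq_infinite_Field[OF infinite_L _ _ Card_order] by blast
  then have 1: "|?P| \<le>o |L|" using rL ordIso_symmetric ordLeq_ordIso_trans by blast
  have "inj_on (\<lambda>x. list_seq [x]) L"
    by (rule inj_onI) (auto simp: list_seq_def fun_eq_iff split: if_splits)
  moreover have "(\<lambda>x. list_seq [x]) ` L \<subseteq> ?P" by (auto simp: image_iff)
  ultimately have "|L| \<le>o |?P|" using card_of_ordLeq[of L ?P] by blast
  then have "|L| =o |?P|" using 1 by (simp add: ordIso_iff_ordLeq)
  then show thesis using that card_of_ordIso[of L ?P] by blast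
qed

section \<open>Recovering the parameter from an image point\<close>

text \<open>The index 0 is skipped because \<open>a 0\<close> may be the least element of \<open>L\<close>, with nothing below it.\<close>

definition rate :: "(nat \<Rightarrow> 'a) \<Rightarrow> ('a \<Rightarrow> 'a \<Rightarrow> real) \<Rightarrow> 'a \<Rightarrow> real \<Rightarrow> bool" where
  "rate a e y t \<longleftrightarrow> (\<exists>C>0. \<forall>n.
     (\<exists>z. z \<prec> a (Suc n) \<and> e z y \<le> C * t ^ Suc n) \<and>
     (\<forall>z. z \<prec> a (Suc n) \<longrightarrow> t ^ Suc n \<le> C * e z y))"

text \<open>The point \<open>z\<close> witnessing the upper bound for \<open>s\<close> is also
  subject to the lower bound for \<open>t\<close>. Used in both directions, this shows that
  \<open>a\<close>, \<open>e\<close> and \<open>y\<close> determine the parameter.\<close>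

lemma rate_le:
  assumes "rate a e y t" "rate a e y s" "0 < s"
  shows "t \<le> s"
proof -
  obtain C where C: "C > 0" "\<And>n z. z \<prec> a (Suc n) \<Longrightarrow> t ^ Suc n \<le> C * e z y"
    using assms(1) unfolding rate_def by blast
  obtain C' where C': "\<And>n. \<exists>z. z \<prec> a (Suc n) \<and> e z y \<le> C' * s ^ Suc n"
    using assms(2) unfolding rate_def by blast
  have "t ^ Suc n \<le> (C * C') * s ^ Suc n" for n
  proof -
    obtain z where z: "z \<prec> a (Suc n)" "e z y \<le> C' * s ^ Suc n" using C' by blast
    have "t ^ Suc n \<le> C * e z y" using C(2) z(1) by blast
    also have "\<dots> \<le> C * (C' * s ^ Suc n)" using z(2) C(1) by (intro mult_left_mono) auto
    finally show ?thesis by (simp only: mult.assoc)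
  qed
  then show ?thesis using le_if_powers_le_const_mult[OF assms(3)] by blast
qed

lemma rate_of_bilipschitz_image:
  fixes b :: "'a \<Rightarrow> nat \<Rightarrow> 'a"
  assumes b: "\<And>E. club E \<Longrightarrow> \<exists>\<delta>\<in>L. \<forall>n. b \<delta> n \<in> E \<and> b \<delta> n \<prec> b \<delta> (Suc n)"
    and \<phi>: "bij_betw \<phi> L (list_seq ` lists L \<union> (\<lambda>\<delta> n. Some (b \<delta> n)) ` L)"
    and t: "0 < t" "t < 1"
    and e: "metric_on L e"
    and K: "K \<ge> 1" and f: "f ` L \<subseteq> L"
    and bilip: "\<And>x y. x \<in> L \<Longrightarrow> y \<in> L \<Longrightarrow> seq_dist t \<phi> x y / K \<le> e (f x) (f y) \<and>
      e (f x) (f y) \<le> K * seq_dist t \<phi> x y"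
  shows "\<exists>y\<in>L. \<exists>\<delta>\<in>L. rate (b \<delta>) e y t"
proof -
  let ?P = "list_seq ` lists L \<union> (\<lambda>\<delta> n. Some (b \<delta> n)) ` L"
  define \<psi> where "\<psi> = inv_into L \<phi>"
  have \<psi>: "\<psi> p \<in> L" "\<phi> (\<psi> p) = p" if "p \<in> ?P" for p
    using that \<phi> unfolding \<psi>_def bij_betw_def
    by (metis inv_into_into, metis f_inv_into_f)
  \<comment> \<open>Two errors below \<open>t ^ n / (2 * K)\<close> add up to less than
    \<open>t ^ n / K\<close>, the lower Lipschitz bound at distance \<open>t ^ n\<close>. Without an
    approximant the choice is arbitrary, hence the intersection with \<open>L\<close> in
    \<open>S\<close>.\<close>
  define g where "g z n = (SOME x. x \<in> L \<and> e z (f x) < t ^ n / (2 * K))" for z and n :: nat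
  \<comment> \<open>All that must stay below a closure point above \<open>\<beta>\<close>: the
    entries of the sequence named by \<open>\<beta>\<close>, the names of finite sequences with
    entries up to \<open>\<beta>\<close>, the image of \<open>\<beta>\<close>, and its
    approximants.\<close>
  define S where "S \<beta> = {\<gamma> \<in> L. \<exists>n. \<phi> \<beta> n = Some \<gamma>} \<union> \<psi> ` list_seq ` lists {y. y \<preceq> \<beta>}
    \<union> {f \<beta>} \<union> (L \<inter> range (g \<beta>))" for \<beta>
  have "\<exists>u\<in>L. \<forall>k\<in>S \<beta>. k \<prec> u" if \<beta>: "\<beta> \<in> L" for \<beta>
  proof (rule bounded)
    have "lists {y. y \<preceq> \<beta>} \<subseteq> lists L" by (rule lists_mono) (auto simp: Field_def)
    then have "list_seq ` lists {y. y \<preceq> \<beta>} \<subseteq> ?P" by (rule subset_trans[OF image_mono Un_upper1])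
    then have "\<psi> ` list_seq ` lists {y. y \<preceq> \<beta>} \<subseteq> L" using \<psi>(1) by (meson image_subsetI subsetD)
    then show "S \<beta> \<subseteq> L" using f \<beta> unfolding S_def by blast
    have "{\<gamma> \<in> L. \<exists>n. \<phi> \<beta> n = Some \<gamma>} \<subseteq> (\<lambda>n. the (\<phi> \<beta> n)) ` UNIV"
    proof
      fix \<gamma> assume "\<gamma> \<in> {\<gamma> \<in> L. \<exists>n. \<phi> \<beta> n = Some \<gamma>}"
      then obtain n where "\<phi> \<beta> n = Some \<gamma>" by blast
      then have "\<gamma> = the (\<phi> \<beta> n)" by simp
      then show "\<gamma> \<in> (\<lambda>n. the (\<phi> \<beta> n)) ` UNIV" by blast
    qed
    then have 1: "small {\<gamma> \<in> L. \<exists>n. \<phi> \<beta> n = Some \<gamma>}"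
      using small_subset small_image[OF small_nat] by blast
    have 2: "small (\<psi> ` list_seq ` lists {y. y \<preceq> \<beta>})"
      by (intro small_image small_lists small_below \<beta>)
    have 3: "small {f \<beta>}" by (simp add: small_finite)
    have 4: "small (L \<inter> range (g \<beta>))"
      by (rule small_subset[OF small_image[OF small_nat]]) blast
    show "small (S \<beta>)"
      unfolding S_def using small_Un[OF small_Un[OF small_Un[OF 1 2] 3] 4] .
  qed
  then obtain h where h: "\<And>\<beta>. \<beta> \<in> L \<Longrightarrow> h \<beta> \<in> L \<and> (\<forall>k\<in>S \<beta>. k \<prec> h \<beta>)" by metis
  define E where "E = {\<alpha> \<in> L. \<forall>\<beta>. \<beta> \<prec> \<alpha> \<longrightarrow> h \<beta> \<prec> \<alpha>}"
  have "club E" unfolding E_def by (rule club_closure_points) (use h in blast)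
  then obtain \<delta> where \<delta>: "\<delta> \<in> L" "\<And>n. b \<delta> n \<in> E" "\<And>n. b \<delta> n \<prec> b \<delta> (Suc n)"
    using b by metis
  define a where "a = b \<delta>"
  have SE: "k \<prec> a n" if "\<beta> \<prec> a n" "k \<in> S \<beta>" for k \<beta> n
  proof -
    have "\<beta> \<in> L" using that(1) by (auto simp: Field_def)
    then have "k \<preceq> h \<beta>" using h that(2) by blast
    moreover have "h \<beta> \<prec> a n" using \<delta>(2)[of n] that(1) by (simp add: E_def a_def)
    ultimately show ?thesis by (rule le_lt_trans)
  qed
  have aL: "a n \<in> L" for n using \<delta>(2)[of n] by (simp add: E_def a_def)
  have amono: "a k \<preceq> a n" if "k \<le> n" for k n
    using that
  proof (induction rule: dec_induct)
    case base
    show ?case using le_refl[OF aL] .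
  next
    case (step n)
    then show ?case using le_trans conjunct2[OF \<delta>(3)] unfolding a_def by blast
  qed
  define x where "x = \<psi> (\<lambda>n. Some (a n))"
  have xL: "x \<in> L" and \<phi>x: "\<phi> x n = Some (a n)" for n
    using \<psi>[of "\<lambda>n. Some (a n)"] \<delta>(1) by (auto simp: x_def a_def)
  have "rate a e (f x) t"
    unfolding rate_def
  proof (intro exI[of _ "2 * K"] conjI allI impI)
    show "0 < 2 * K" using K by simp
    fix n
    show "\<exists>z. z \<prec> a (Suc n) \<and> e z (f x) \<le> 2 * K * t ^ Suc n"
    proof -
      \<comment> \<open>The list runs from \<open>a 0\<close> to \<open>a n\<close>; its code
        continues with \<open>None\<close>, so \<open>w\<close> and \<open>x\<close> first differ at
        place \<open>Suc n\<close>.\<close>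
      define l where "l = map a [0..<Suc n]"
      define w where "w = \<psi> (list_seq l)"
      have "l \<in> lists {y. y \<preceq> a n}" using amono by (auto simp: l_def)
      then have "w \<in> S (a n)" unfolding S_def w_def by blast
      moreover have "a n \<prec> a (Suc n)" using \<delta>(3) by (simp add: a_def)
      ultimately have w: "w \<prec> a (Suc n)" using SE by blast
      have "l \<in> lists L" using aL by (auto simp: l_def)
      then have wL: "w \<in> L" and \<phi>w: "\<phi> w = list_seq l" using \<psi>[of "list_seq l"] by (auto simp: w_def)
      have "seq_dist t \<phi> w x = t ^ Suc n"
        by (rule seq_dist_eq) (auto simp: \<phi>w \<phi>x list_seq_def l_def nth_append simp del: upt_Suc)
      then have "e (f w) (f x) \<le> K * t ^ Suc n" using bilip[OF wL xL] by simp
      also have "\<dots> \<le> 2 * K * t ^ Suc n" using K t by simp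
      finally have "e (f w) (f x) \<le> 2 * K * t ^ Suc n" .
      moreover have "f w \<prec> a (Suc n)" by (rule SE[OF w]) (simp add: S_def)
      ultimately show ?thesis by blast
    qed
    fix z assume z: "z \<prec> a (Suc n)"
    then have zL: "z \<in> L" by (auto simp: Field_def)
    \<comment> \<open>If \<open>z\<close> were too close to \<open>f x\<close>, its approximant
      \<open>?v\<close> would lie below \<open>a (Suc n)\<close>, and so would all entries of the
      label of \<open>?v\<close>. Hence \<open>?v\<close> and \<open>x\<close> differ at place
      \<open>Suc n\<close> at the latest, which keeps their images too far apart.\<close>
    show "t ^ Suc n \<le> 2 * K * e z (f x)"
    proof (rule ccontr)
      assume "\<not> t ^ Suc n \<le> 2 * K * e z (f x)"
      then have zx: "e z (f x) < t ^ Suc n / (2 * K)"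
        using K by (simp add: field_simps)
      then have "\<exists>x. x \<in> L \<and> e z (f x) < t ^ Suc n / (2 * K)" using xL by blast
      from someI_ex[OF this, folded g_def]
      have g: "g z (Suc n) \<in> L" "e z (f (g z (Suc n))) < t ^ Suc n / (2 * K)" by blast+
      let ?v = "g z (Suc n)"
      have v: "?v \<prec> a (Suc n)" by (rule SE[OF z]) (use g(1) in \<open>simp add: S_def\<close>)
      have "\<phi> ?v (Suc n) \<noteq> \<phi> x (Suc n)"
      proof
        assume "\<phi> ?v (Suc n) = \<phi> x (Suc n)"
        then have "a (Suc n) \<in> S ?v" using aL unfolding S_def \<phi>x by blast
        then show False using SE[OF v] by blast
      qed
      then have "t ^ Suc n \<le> seq_dist t \<phi> ?v x" by (rule seq_dist_ge[OF t])
      then have "t ^ Suc n / K \<le> seq_dist t \<phi> ?v x / K"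
        using K by (intro divide_right_mono) auto
      also have "\<dots> \<le> e (f ?v) (f x)" using bilip[OF g(1) xL] by blast
      also have "\<dots> \<le> e z (f ?v) + e z (f x)"
      proof -
        have "f ?v \<in> L" "f x \<in> L" using f g(1) xL by blast+
        then show ?thesis using e zL unfolding metric_on_def by metis
      qed
      also have "\<dots> < t ^ Suc n / (2 * K) + t ^ Suc n / (2 * K)" using g(2) zx by (rule add_strict_mono)
      also have "\<dots> = t ^ Suc n / K" using K by (simp add: field_simps)
      finally show False by simp
    qed
  qed
  moreover have "f x \<in> L" using f xL by blast
  ultimately show ?thesis using \<delta>(1) by (auto simp: a_def)
qed

section \<open>Choosing the parameter by counting\<close>

text \<open>By \<open>rate_le\<close> each triple of an index, a point and a guessing sequence
  excludes at most one parameter, so fewer than continuum many are excluded.\<close>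

lemma ex_ultrametric_not_bilip_embeds:
  fixes I :: "'i set" and D :: "'i \<Rightarrow> 'a \<Rightarrow> 'a \<Rightarrow> real"
  assumes r: "r <o |UNIV :: real set|" and I: "|I| <o |UNIV :: real set|"
    and D: "\<And>i. i \<in> I \<Longrightarrow> metric_on L (D i)"
  shows "\<exists>d. ultrametric_on L d \<and> (\<forall>i\<in>I. \<not> bilip_embeds L d L (D i))"
proof -
  obtain b :: "'a \<Rightarrow> nat \<Rightarrow> 'a"
    where b: "\<And>E. club E \<Longrightarrow> \<exists>\<delta>\<in>L. \<forall>n. b \<delta> n \<in> E \<and> b \<delta> n \<prec> b \<delta> (Suc n)"
    using club_guessing by metis
  obtain \<phi> where \<phi>: "bij_betw \<phi> L (list_seq ` lists L \<union> (\<lambda>\<delta> n. Some (b \<delta> n)) ` L)"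
    using ex_enumeration_of_sequences by blast
  \<comment> \<open>An injection of the reals into \<open>(0,1)\<close>, so that excluded parameters
    can be counted against all reals.\<close>
  define \<rho> :: "real \<Rightarrow> real" where "\<rho> u = inverse (1 + exp u)" for u
  have \<rho>: "0 < \<rho> u" "\<rho> u < 1" for u
    by (auto simp: \<rho>_def add_pos_pos inverse_less_1_iff)
  have \<rho>_inj: "u = v" if "\<rho> u = \<rho> v" for u v
    using that by (simp add: \<rho>_def)
  define T where "T = {u. \<exists>i\<in>I. \<exists>y\<in>L. \<exists>\<delta>\<in>L. rate (b \<delta>) (D i) y (\<rho> u)}"
  have "T \<subseteq> (\<lambda>(i, y, \<delta>). THE u. rate (b \<delta>) (D i) y (\<rho> u)) ` (I \<times> L \<times> L)"
  proof
    fix u assume "u \<in> T"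
    then obtain i y \<delta> where *: "i \<in> I" "y \<in> L" "\<delta> \<in> L" "rate (b \<delta>) (D i) y (\<rho> u)"
      unfolding T_def by blast
    have "(THE u. rate (b \<delta>) (D i) y (\<rho> u)) = u"
    proof (rule the_equality)
      show "rate (b \<delta>) (D i) y (\<rho> u)" by (rule *(4))
    next
      fix v assume v: "rate (b \<delta>) (D i) y (\<rho> v)"
      show "v = u"
        by (rule \<rho>_inj[OF antisym[OF rate_le[OF v *(4) \<rho>(1)] rate_le[OF *(4) v \<rho>(1)]]])
    qed
    then show "u \<in> (\<lambda>(i, y, \<delta>). THE u. rate (b \<delta>) (D i) y (\<rho> u)) ` (I \<times> L \<times> L)"
      using * by (force simp: image_iff)
  qed
  then have "|T| \<le>o |I \<times> L \<times> L|"
    using card_of_image card_of_mono1 ordLeq_transitive by blast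
  moreover have "|L| <o |UNIV :: real set|"
    using card_of_Field_ordIso[OF Card_order] r ordIso_ordLess_trans by blast
  then have "|I \<times> L \<times> L| <o |UNIV :: real set|"
    using card_of_Times_Times_ordLess[OF infinite_UNIV_char_0 I] infinite_L by blast
  ultimately have "|T| <o |UNIV :: real set|" using ordLeq_ordLess_trans by blast
  then have "T \<noteq> UNIV" using ordLess_irreflexive by blast
  then obtain u where u: "u \<notin> T" by blast
  let ?d = "seq_dist (\<rho> u) \<phi>"
  have "ultrametric_on L ?d"
    using ultrametric_on_seq_dist[OF \<rho>] \<phi> bij_betw_imp_inj_on by blast
  moreover have "\<not> bilip_embeds L ?d L (D i)" if i: "i \<in> I" for i
  proof
    assume "bilip_embeds L ?d L (D i)"
    then obtain K f where K: "K \<ge> 1" and f: "f ` L \<subseteq> L" and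
      bl: "\<forall>x\<in>L. \<forall>y\<in>L. ?d x y / K \<le> D i (f x) (f y) \<and> D i (f x) (f y) \<le> K * ?d x y"
      unfolding bilip_embeds_def by (elim exE conjE) (rule that)
    have "\<exists>y\<in>L. \<exists>\<delta>\<in>L. rate (b \<delta>) (D i) y (\<rho> u)"
      by (rule rate_of_bilipschitz_image[OF b \<phi> \<rho> D[OF i] K f bspec[OF bspec[OF bl]]])
    then show False using u i unfolding T_def by blast
  qed
  ultimately show ?thesis by blast
qed

end

section \<open>Arbitrary target spaces\<close>

text \<open>Take the factor 2. The metric axioms settle equal points, about which almost isometry
  says nothing.\<close>

lemma bilip_embeds_if_almost_isom_embeds:
  assumes "almost_isom_embeds L d M e" "metric_on L d" "metric_on M e"
  shows "bilip_embeds L d M e"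
proof -
  obtain f where f: "inj_on f L" "f ` L \<subseteq> M"
    "\<And>a b. a \<in> L \<Longrightarrow> b \<in> L \<Longrightarrow> a \<noteq> b \<Longrightarrow> e (f a) (f b) < 2 * d a b \<and> d a b < 2 * e (f a) (f b)"
    using assms(1) unfolding almost_isom_embeds_def
    by (metis one_less_numeral_iff semiring_norm(76))
  have "d x y / 2 \<le> e (f x) (f y) \<and> e (f x) (f y) \<le> 2 * d x y" if "x \<in> L" "y \<in> L" for x y
  proof (cases "x = y")
    case True
    have "d y y = 0" "e (f y) (f y) = 0"
      using assms(2,3) f(2) that unfolding metric_on_def by blast+
    then show ?thesis using True by simp
  next
    case False
    then show ?thesis using f(3)[OF that] by simp
  qed
  then show ?thesis unfolding bilip_embeds_def using f(1,2)
    by (intro exI[of _ 2] conjI exI[of _ f]) auto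
qed

lemma metric_on_pullback:
  assumes "metric_on M e" "inj_on g L" "g ` L \<subseteq> M"
  shows "metric_on L (\<lambda>x y. e (g x) (g y))"
proof -
  have "g x \<in> M" if "x \<in> L" for x using assms(3) that by blast
  then show ?thesis using assms(1,2) unfolding metric_on_def by (simp add: inj_on_eq_iff)
qed

text \<open>Composing with the inverse of \<open>g\<close> reduces a target \<open>M\<close> of size
  \<open>r\<close> to a metric on the cardinal itself.\<close>

lemma bilip_embeds_pullback:
  assumes "bilip_embeds L d M e" "bij_betw g L' M"
  shows "bilip_embeds L d L' (\<lambda>x y. e (g x) (g y))"
proof -
  obtain K f where K: "K \<ge> 1" and f: "inj_on f L" "f ` L \<subseteq> M"
    "\<forall>x\<in>L. \<forall>y\<in>L. d x y / K \<le> e (f x) (f y) \<and> e (f x) (f y) \<le> K * d x y"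
    using assms(1) unfolding bilip_embeds_def by blast
  let ?f = "inv_into L' g \<circ> f"
  have M: "M = g ` L'" using assms(2) by (simp add: bij_betw_def)
  have "inj_on ?f L"
    using f(1,2) M by (intro comp_inj_on) (auto intro: inj_on_subset[OF inj_on_inv_into])
  moreover have fM: "f x \<in> g ` L'" if "x \<in> L" for x using f(2) M that by blast
  then have "?f ` L \<subseteq> L'" by (auto simp: inv_into_into)
  moreover have "g (?f x) = f x" if "x \<in> L" for x
    using fM[OF that] by (simp add: f_inv_into_f)
  ultimately show ?thesis
    unfolding bilip_embeds_def using K f(3) by (intro exI[of _ K] conjI exI[of _ ?f]) auto
qed

theorem theorem6p2:
  fixes r :: "'a rel"
    and I :: "'i set"
    and D :: "'i \<Rightarrow> 'a \<Rightarrow> 'a \<Rightarrow> real"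
  assumes "Card_order r"
    and "regularCard r"
    and "(cardSuc natLeq, r) \<in> ordLess"
    and "(r, card_of (UNIV :: real set)) \<in> ordLess"
    and "(card_of I, card_of (UNIV :: real set)) \<in> ordLess"
    and "\<forall>i\<in>I. metric_on (Field r) (D i)"
  shows "(\<exists>d. ultrametric_on (Field r) d \<and>
            (\<forall>i\<in>I. \<not> (\<exists>K::real. K \<ge> 1 \<and> (\<exists>f. inj_on f (Field r) \<and> f ` Field r \<subseteq> Field r \<and>
               (\<forall>x\<in>Field r. \<forall>y\<in>Field r.
                  d x y / K \<le> D i (f x) (f y) \<and> D i (f x) (f y) \<le> K * d x y))))) \<and>
         (\<forall>(M :: 'b set) (e :: 'b \<Rightarrow> 'b \<Rightarrow> real).
            (card_of M, r) \<in> ordIso \<and> metric_on M e \<longrightarrow>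
            (\<exists>d. ultrametric_on (Field r) d \<and> \<not> bilip_embeds (Field r) d M e) \<and>
            (\<exists>d. ultrametric_on (Field r) d \<and> \<not> almost_isom_embeds (Field r) d M e))"
proof -
  interpret regular_cardinal r using assms(1-3) by unfold_locales
  \<comment> \<open>Transport \<open>e\<close> to \<open>L\<close> along a bijection and apply the
    result for families to the one-element index set \<open>unit\<close>. The same \<open>d\<close>
    refutes both kinds of embedding.\<close>
  have univ: "\<exists>d. ultrametric_on L d \<and> \<not> bilip_embeds L d M e \<and> \<not> almost_isom_embeds L d M e"
    if Mr: "|M| =o r" and e: "metric_on M e" for M :: "'b set" and e
  proof -
    have "|L| =o |M|"
      using card_of_Field_ordIso[OF assms(1)] Mr ordIso_symmetric ordIso_transitive by blast
    then obtain g where g: "bij_betw g L M" using card_of_ordIso[of L M] by blast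
    have "metric_on L (\<lambda>x y. e (g x) (g y))"
      using g by (intro metric_on_pullback[OF e]) (auto simp: bij_betw_def)
    moreover have "|UNIV :: unit set| <o |UNIV :: real set|"
      using small_finite[OF finite_UNIV] assms(4) by (rule ordLess_transitive)
    ultimately obtain d where d: "ultrametric_on L d" "\<not> bilip_embeds L d L (\<lambda>x y. e (g x) (g y))"
      using ex_ultrametric_not_bilip_embeds[OF assms(4), of "UNIV :: unit set" "\<lambda>_ x y. e (g x) (g y)"]
      by blast
    then have "\<not> bilip_embeds L d M e" using bilip_embeds_pullback[OF _ g] by blast
    moreover have "\<not> almost_isom_embeds L d M e"
      using calculation bilip_embeds_if_almost_isom_embeds[OF _ _ e] d(1)
      unfolding ultrametric_on_def by blast
    ultimately show ?thesis using d(1) by blast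
  qed
  show ?thesis
  proof (intro conjI allI impI)
    have "\<exists>d. ultrametric_on L d \<and> (\<forall>i\<in>I. \<not> bilip_embeds L d L (D i))"
      using ex_ultrametric_not_bilip_embeds assms(4-6) by blast
    then show "\<exists>d. ultrametric_on L d \<and>
        (\<forall>i\<in>I. \<not> (\<exists>K::real. K \<ge> 1 \<and> (\<exists>f. inj_on f L \<and> f ` L \<subseteq> L \<and>
          (\<forall>x\<in>L. \<forall>y\<in>L. d x y / K \<le> D i (f x) (f y) \<and> D i (f x) (f y) \<le> K * d x y))))"
      by (simp only: bilip_embeds_def)
  next
    fix M :: "'b set" and e
    assume "|M| =o r \<and> metric_on M e"
    then show "\<exists>d. ultrametric_on L d \<and> \<not> bilip_embeds L d M e"
      and "\<exists>d. ultrametric_on L d \<and> \<not> almost_isom_embeds L d M e"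
      using univ[of M e] by blast+
  qed
qed

end
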